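(* Let $G=(V,E)$ be a graph with $n=|V|$ and $m=|E|$, and let $k$ be a positive integer. Construct $G'=(V',E')$ as follows: replace each vertex $u\in V$ by a path $u_1u_2u_3$; for each edge $e=uv\in E$ add four new vertices $e_u,e_v,e_w,e_z$ with edges $e_ue_v,e_ve_w,e_we_u,e_we_z$, and add the edges $u_3e_u$ and $v_3e_v$. Let $M=\{u_2u_3:u\in V\}\cup\{e_ue_w:e=uv\in E\}$ (choosing, for each edge $e$, one fixed endpoint labelled $u$). Then $M$ is a maximal matching of $G'$ with $|M|=n+m$, and $G$ has an independent set of at least $k$ vertices (equivalently a vertex cover of at most $n-k$ vertices) if and only if $G'$ has a vertex cover with at most $2|M|-k=2n+2m-k$ vertices.
   Context: A vertex cover of a graph is a set of vertices containing at least one endpoint of every edge. A matching is maximal if no edge of the graph can be added to it while keeping it a matching. *)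

theory Defs
  imports Main
begin

definition graph :: "'v set \<Rightarrow> 'v set set \<Rightarrow> bool" where
  "graph V E \<longleftrightarrow> finite V \<and> (\<forall>e\<in>E. \<exists>x y. x \<noteq> y \<and> x \<in> V \<and> y \<in> V \<and> e = {x, y})"

definition vertex_cover :: "'v set \<Rightarrow> 'v set set \<Rightarrow> 'v set \<Rightarrow> bool" where
  "vertex_cover V E C \<longleftrightarrow> C \<subseteq> V \<and> (\<forall>e\<in>E. e \<inter> C \<noteq> {})"

definition independent_set :: "'v set \<Rightarrow> 'v set set \<Rightarrow> 'v set \<Rightarrow> bool" where
  "independent_set V E S \<longleftrightarrow> S \<subseteq> V \<and> (\<forall>e\<in>E. \<not> e \<subseteq> S)"

definition matching :: "'v set set \<Rightarrow> 'v set set \<Rightarrow> bool" where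
  "matching E M \<longleftrightarrow> M \<subseteq> E \<and> (\<forall>e1\<in>M. \<forall>e2\<in>M. e1 \<noteq> e2 \<longrightarrow> e1 \<inter> e2 = {})"

definition maximal_matching :: "'v set set \<Rightarrow> 'v set set \<Rightarrow> bool" where
  "maximal_matching E M \<longleftrightarrow> matching E M \<and> (\<forall>e\<in>E - M. \<not> matching E (insert e M))"

text \<open>Vertices of the constructed graph G'.
  PV u i is u_i (i = 1,2,3);
  EVx e x is the gadget vertex e_x attached to x_3 (x an endpoint of e);
  EW e and EZ e are e_w and e_z.\<close>

datatype 'a gvert = PV 'a nat | EVx "'a set" 'a | EW "'a set" | EZ "'a set"

definition red_vertices :: "'a set \<Rightarrow> 'a set set \<Rightarrow> 'a gvert set" where
  "red_vertices V E =
     {PV u i | u i. u \<in> V \<and> i \<in> {1, 2, 3}}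
   \<union> {EVx e x | e x. e \<in> E \<and> x \<in> e}
   \<union> {EW e | e. e \<in> E}
   \<union> {EZ e | e. e \<in> E}"

definition red_edges :: "'a set \<Rightarrow> 'a set set \<Rightarrow> 'a gvert set set" where
  "red_edges V E =
     {{PV u 1, PV u 2} | u. u \<in> V}
   \<union> {{PV u 2, PV u 3} | u. u \<in> V}
   \<union> {{EVx e x, EVx e y} | e x y. e \<in> E \<and> x \<noteq> y \<and> e = {x, y}}
   \<union> {{EVx e x, EW e} | e x. e \<in> E \<and> x \<in> e}
   \<union> {{EW e, EZ e} | e. e \<in> E}
   \<union> {{PV x 3, EVx e x} | e x. e \<in> E \<and> x \<in> e}"

text \<open>The matching M, where t e is the fixed chosen endpoint (labelled u) of edge e.\<close>

definition red_matching :: "'a set \<Rightarrow> 'a set set \<Rightarrow> ('a set \<Rightarrow> 'a) \<Rightarrow> 'a gvert set set" where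
  "red_matching V E t =
     {{PV u 2, PV u 3} | u. u \<in> V} \<union> {{EVx e (t e), EW e} | e. e \<in> E}"

end

theory Submission
  imports Defs
begin

text \<open>
  (1) M is a matching, and every edge of G' meets an edge of M; hence M is
      maximal.  M contains one edge per vertex and one per edge of G.
  (2) Independent sets of G are exactly the complements of vertex covers.
  (3) A vertex cover C of G lifts to a cover of G' of size |V| + |C| + 2|E|:
      take every u2, u3 for u in C, every e_w, and for each edge e the vertex
      e_s of an endpoint s whose partner endpoint lies in C.
  (4) Conversely, any cover C' of G' meets every path in at least one vertex,
      in two if it contains u3, and every gadget in at least two vertices, in
      three if neither link vertex x3, y3 is in C'.  Counting block by block,
      the set of u with u3 in C', together with one endpoint of every edge not
      covered that way, is a cover C of G with |V| + |C| + 2|E| <= |C'|.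
\<close>

lemma graph_edgeE:
  assumes "graph V E" "e \<in> E"
  obtains x y where "x \<noteq> y" "x \<in> V" "y \<in> V" "e = {x, y}"
  using assms unfolding graph_def by blast

lemma graph_finite:
  assumes "graph V E"
  shows "finite V" "finite E" "\<And>e. e \<in> E \<Longrightarrow> e \<subseteq> V"
proof -
  show fin: "finite V" using assms unfolding graph_def by blast
  show sub: "\<And>e. e \<in> E \<Longrightarrow> e \<subseteq> V" by (metis assms graph_edgeE empty_subsetI insert_subset)
  then have "E \<subseteq> Pow V" by blast
  then show "finite E" using fin by (simp add: finite_subset)
qed

lemma independent_set_iff_cover_complement:
  assumes "\<And>e. e \<in> E \<Longrightarrow> e \<subseteq> V" "S \<subseteq> V"
  shows "independent_set V E S \<longleftrightarrow> vertex_cover V E (V - S)"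
  using assms unfolding independent_set_def vertex_cover_def by blast

lemma independent_set_iff_small_cover:
  assumes "graph V E"
  shows "(\<exists>S. independent_set V E S \<and> card S \<ge> k)
     \<longleftrightarrow> (\<exists>C. vertex_cover V E C \<and> int (card C) \<le> int (card V) - int k)"
proof
  assume "\<exists>S. independent_set V E S \<and> card S \<ge> k"
  then obtain S where S: "independent_set V E S" "card S \<ge> k" by blast
  have SV: "S \<subseteq> V" using S(1) unfolding independent_set_def by blast
  then have "vertex_cover V E (V - S)"
    using S(1) independent_set_iff_cover_complement[OF graph_finite(3)[OF assms]] by blast
  moreover have "card (V - S) = card V - card S" "card S \<le> card V"
    using SV graph_finite(1)[OF assms] by (auto simp: card_Diff_subset finite_subset card_mono)
  ultimately show "\<exists>C. vertex_cover V E C \<and> int (card C) \<le> int (card V) - int k"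
    using S(2) by (intro exI[of _ "V - S"]) auto
next
  assume "\<exists>C. vertex_cover V E C \<and> int (card C) \<le> int (card V) - int k"
  then obtain C where C: "vertex_cover V E C" "int (card C) \<le> int (card V) - int k" by blast
  have CV: "C \<subseteq> V" using C(1) unfolding vertex_cover_def by blast
  then have "V - (V - C) = C" by blast
  then have "independent_set V E (V - C)"
    using C(1) graph_finite(3)[OF assms] independent_set_iff_cover_complement[of E V "V - C"] by auto
  moreover have "card (V - C) = card V - card C"
    using CV graph_finite(1)[OF assms] by (simp add: card_Diff_subset finite_subset)
  ultimately show "\<exists>S. independent_set V E S \<and> card S \<ge> k"
    using C(2) by (intro exI[of _ "V - C"]) auto
qed

lemma red_edges_intros:
  "u \<in> V \<Longrightarrow> {PV u 1, PV u 2} \<in> red_edges V E"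
  "u \<in> V \<Longrightarrow> {PV u 2, PV u 3} \<in> red_edges V E"
  "e \<in> E \<Longrightarrow> x \<noteq> y \<Longrightarrow> e = {x, y} \<Longrightarrow> {EVx e x, EVx e y} \<in> red_edges V E"
  "e \<in> E \<Longrightarrow> x \<in> e \<Longrightarrow> {EVx e x, EW e} \<in> red_edges V E"
  "e \<in> E \<Longrightarrow> {EW e, EZ e} \<in> red_edges V E"
  "e \<in> E \<Longrightarrow> x \<in> e \<Longrightarrow> {PV x 3, EVx e x} \<in> red_edges V E"
  unfolding red_edges_def by (auto simp: doubleton_eq_iff)

lemma red_edgesE:
  assumes "f \<in> red_edges V E"
  obtains (path12) u where "u \<in> V" "f = {PV u 1, PV u 2}"
  | (path23) u where "u \<in> V" "f = {PV u 2, PV u 3}"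
  | (base) e x y where "e \<in> E" "x \<noteq> y" "e = {x, y}" "f = {EVx e x, EVx e y}"
  | (side) e x where "e \<in> E" "x \<in> e" "f = {EVx e x, EW e}"
  | (pendant) e where "e \<in> E" "f = {EW e, EZ e}"
  | (link) e x where "e \<in> E" "x \<in> e" "f = {PV x 3, EVx e x}"
  using assms unfolding red_edges_def by blast

section \<open>The matching M\<close>

lemma maximal_matchingI:
  assumes "matching E M" "\<And>f. f \<in> E \<Longrightarrow> \<exists>g\<in>M. f \<inter> g \<noteq> {}"
  shows "maximal_matching E M"
  unfolding maximal_matching_def
proof (intro conjI ballI notI)
  fix f assume f: "f \<in> E - M" and "matching E (insert f M)"
  then have disjoint: "\<forall>g\<in>insert f M. g \<noteq> f \<longrightarrow> f \<inter> g = {}"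
    unfolding matching_def by blast
  obtain g where "g \<in> M" "f \<inter> g \<noteq> {}" using assms(2) f by blast
  moreover have "g \<noteq> f" using \<open>g \<in> M\<close> f by blast
  ultimately show False using disjoint by blast
qed (rule assms(1))

lemma red_matching_image:
  "red_matching V E t = (\<lambda>u. {PV u 2, PV u 3}) ` V \<union> (\<lambda>e. {EVx e (t e), EW e}) ` E"
  unfolding red_matching_def by blast

lemma red_matching_is_matching:
  assumes "\<forall>e\<in>E. t e \<in> e"
  shows "matching (red_edges V E) (red_matching V E t)"
proof -
  have "red_matching V E t \<subseteq> red_edges V E"
    unfolding red_matching_image using assms by (auto intro: red_edges_intros(2,4))
  moreover have "f \<inter> g = {}"
    if "f \<in> red_matching V E t" "g \<in> red_matching V E t" "f \<noteq> g" for f g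
    using that unfolding red_matching_image by auto
  ultimately show ?thesis unfolding matching_def by blast
qed

text \<open>Every edge of G' shares a vertex with an edge of M: path edges and link
  edges meet u2 u3, gadget edges meet e_t e_w (the base contains e_t).\<close>

lemma red_matching_meets_all_edges:
  assumes "graph V E" "\<forall>e\<in>E. t e \<in> e" "f \<in> red_edges V E"
  shows "\<exists>g\<in>red_matching V E t. f \<inter> g \<noteq> {}"
proof -
  have path: "{PV u 2, PV u 3} \<in> red_matching V E t" if "u \<in> V" for u
    using that unfolding red_matching_image by blast
  have gadget: "{EVx e (t e), EW e} \<in> red_matching V E t" if "e \<in> E" for e
    using that unfolding red_matching_image by blast
  have meets: "\<exists>g\<in>red_matching V E t. f \<inter> g \<noteq> {}"
    if "g \<in> red_matching V E t" "v \<in> f" "v \<in> g" for g v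
    using that by blast
  from assms(3) show ?thesis
  proof (cases rule: red_edgesE)
    case (path12 u)
    then show ?thesis using meets[OF path[of u], of "PV u 2"] by simp
  next
    case (path23 u)
    then show ?thesis using meets[OF path[of u], of "PV u 2"] by simp
  next
    case (base e x y)
    then have "t e \<in> {x, y}" using assms(2) by blast
    then show ?thesis using base meets[OF gadget[of e], of "EVx e (t e)"] by auto
  next
    case (side e x)
    then show ?thesis using meets[OF gadget[of e], of "EW e"] by simp
  next
    case (pendant e)
    then show ?thesis using meets[OF gadget[of e], of "EW e"] by simp
  next
    case (link e x)
    then have "x \<in> V" using graph_finite(3)[OF assms(1)] by blast
    then show ?thesis using link meets[OF path[of x], of "PV x 3"] by simp
  qed
qed

lemma red_matching_maximal:
  assumes "graph V E" "\<forall>e\<in>E. t e \<in> e"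
  shows "maximal_matching (red_edges V E) (red_matching V E t)"
  using maximal_matchingI red_matching_is_matching[OF assms(2)]
    red_matching_meets_all_edges[OF assms] by blast

lemma card_red_matching:
  assumes "graph V E"
  shows "card (red_matching V E t) = card V + card E"
proof -
  have "inj_on (\<lambda>u. {PV u 2, PV u 3}) V" "inj_on (\<lambda>e. {EVx e (t e), EW e}) E"
    by (auto intro!: inj_onI simp: doubleton_eq_iff)
  moreover have "(\<lambda>u. {PV u 2, PV u 3}) ` V \<inter> (\<lambda>e. {EVx e (t e), EW e}) ` E = {}"
    by (auto simp: doubleton_eq_iff)
  ultimately show ?thesis
    unfolding red_matching_image using graph_finite[OF assms] by (simp add: card_Un_disjoint card_image)
qed

section \<open>Lifting a vertex cover of G to G'\<close>

lemma covered_edge_endpoint: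
  assumes "x \<noteq> y" "e = {x, y}" "e \<inter> C \<noteq> {}"
  shows "\<exists>z\<in>e. e - {z} \<subseteq> C"
  using assms by blast

lemma cover_lift:
  assumes "graph V E" "vertex_cover V E C"
  shows "\<exists>C'. vertex_cover (red_vertices V E) (red_edges V E) C'
              \<and> card C' \<le> card V + card C + 2 * card E"
proof -
  have CV: "C \<subseteq> V" and covered: "\<And>e. e \<in> E \<Longrightarrow> e \<inter> C \<noteq> {}"
    using assms(2) unfolding vertex_cover_def by auto
  have fin: "finite V" "finite E" "finite C"
    using graph_finite[OF assms(1)] CV finite_subset by auto
  define s where "s e = (SOME z. z \<in> e \<and> e - {z} \<subseteq> C)" for e
  have s: "s e \<in> e" "e - {s e} \<subseteq> C" if e: "e \<in> E" for e
  proof -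
    obtain x y where "x \<noteq> y" "e = {x, y}" using graph_edgeE[OF assms(1) e] by blast
    then have "\<exists>z. z \<in> e \<and> e - {z} \<subseteq> C"
      using covered_edge_endpoint covered[OF e] by blast
    then show "s e \<in> e" "e - {s e} \<subseteq> C" unfolding s_def by (metis (mono_tags) someI_ex)+
  qed
  define C' where "C' = (\<lambda>u. PV u 2) ` V \<union> (\<lambda>u. PV u 3) ` C \<union> EW ` E \<union> (\<lambda>e. EVx e (s e)) ` E"
  have "card C' \<le> card ((\<lambda>u. PV u 2) ` V) + card ((\<lambda>u. PV u 3) ` C)
                   + card (EW ` E) + card ((\<lambda>e. EVx e (s e)) ` E)"
    unfolding C'_def by (meson card_Un_le add_le_mono order_refl order_trans)
  also have "\<dots> \<le> card V + card C + 2 * card E"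
    using card_image_le[OF fin(1), of "\<lambda>u. PV u 2"] card_image_le[OF fin(3), of "\<lambda>u. PV u 3"]
      card_image_le[OF fin(2), of EW] card_image_le[OF fin(2), of "\<lambda>e. EVx e (s e)"] by linarith
  finally have card: "card C' \<le> card V + card C + 2 * card E" .
  have "C' \<subseteq> red_vertices V E"
    using CV s(1) unfolding C'_def red_vertices_def by blast
  moreover have "f \<inter> C' \<noteq> {}" if "f \<in> red_edges V E" for f
    using that
  proof (cases rule: red_edgesE)
    case (base e x y)
    then have "EVx e (s e) \<in> f \<inter> C'" using s(1) unfolding C'_def by auto
    then show ?thesis by blast
  next
    case (link e x)
    then have "x = s e \<or> x \<in> C" using s(2) by blast
    then show ?thesis using link unfolding C'_def by auto
  qed (auto simp: C'_def)
  ultimately show ?thesis using card unfolding vertex_cover_def by blast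
qed

section \<open>Projecting a vertex cover of G' to G\<close>

definition vertex_path :: "'a \<Rightarrow> 'a gvert set" where
  "vertex_path u = {PV u 1, PV u 2, PV u 3}"

definition edge_gadget :: "'a set \<Rightarrow> 'a gvert set" where
  "edge_gadget e = insert (EW e) (insert (EZ e) (EVx e ` e))"

lemma red_vertices_blocks:
  "red_vertices V E \<subseteq> (\<Union>u\<in>V. vertex_path u) \<union> (\<Union>e\<in>E. edge_gadget e)"
  unfolding red_vertices_def vertex_path_def edge_gadget_def by blast

lemma finite_red_vertices:
  assumes "graph V E"
  shows "finite (red_vertices V E)"
proof (rule finite_subset[OF red_vertices_blocks])
  have "finite (edge_gadget e)" if "e \<in> E" for e
    using graph_finite[OF assms] that finite_subset unfolding edge_gadget_def by blast
  then show "finite ((\<Union>u\<in>V. vertex_path u) \<union> (\<Union>e\<in>E. edge_gadget e))"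
    using graph_finite[OF assms] by (simp add: vertex_path_def)
qed

lemma sum_card_blocks_le:
  fixes P :: "'i \<Rightarrow> 'a set" and Q :: "'j \<Rightarrow> 'a set"
  assumes "finite C" "finite I" "finite J"
    and "\<And>i i'. i \<in> I \<Longrightarrow> i' \<in> I \<Longrightarrow> i \<noteq> i' \<Longrightarrow> P i \<inter> P i' = {}"
    and "\<And>j j'. j \<in> J \<Longrightarrow> j' \<in> J \<Longrightarrow> j \<noteq> j' \<Longrightarrow> Q j \<inter> Q j' = {}"
    and "\<And>i j. i \<in> I \<Longrightarrow> j \<in> J \<Longrightarrow> P i \<inter> Q j = {}"
  shows "(\<Sum>i\<in>I. card (C \<inter> P i)) + (\<Sum>j\<in>J. card (C \<inter> Q j)) \<le> card C"
proof -
  let ?X = "\<Union>i\<in>I. C \<inter> P i" and ?Y = "\<Union>j\<in>J. C \<inter> Q j"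
  have "card ?X = (\<Sum>i\<in>I. card (C \<inter> P i))"
    by (rule card_UN_disjoint) (use assms(1,2) in simp, use assms(1) in simp, use assms(4) in blast)
  moreover have "card ?Y = (\<Sum>j\<in>J. card (C \<inter> Q j))"
    by (rule card_UN_disjoint) (use assms(1,3) in simp, use assms(1) in simp, use assms(5) in blast)
  moreover have "card (?X \<union> ?Y) = card ?X + card ?Y"
    by (rule card_Un_disjoint) (use assms(1) in simp, use assms(1) in simp, use assms(6) in blast)
  moreover have "card (?X \<union> ?Y) \<le> card C"
    using assms(1) by (intro card_mono) auto
  ultimately show ?thesis by simp
qed

lemma triangle_cover:
  assumes "a \<noteq> b" "a \<noteq> c" "b \<noteq> c"
    and "{a, b} \<inter> C \<noteq> {}" "{a, c} \<inter> C \<noteq> {}" "{b, c} \<inter> C \<noteq> {}"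
  shows "2 \<le> card (C \<inter> {a, b, c})"
proof -
  obtain p q where "p \<noteq> q" "{p, q} \<subseteq> C \<inter> {a, b, c}" using assms by blast
  then show ?thesis by (metis card_2_iff card_mono finite.emptyI finite.insertI finite_Int)
qed

lemma cover_path_bound:
  assumes cover: "\<And>f. f \<in> red_edges V E \<Longrightarrow> f \<inter> C' \<noteq> {}" and "u \<in> V"
  shows "1 + of_bool (PV u 3 \<in> C') \<le> card (C' \<inter> vertex_path u)"
proof -
  have fin: "finite (C' \<inter> vertex_path u)" by (simp add: vertex_path_def)
  obtain w where w: "w \<in> C'" "w = PV u 1 \<or> w = PV u 2"
    using cover[OF red_edges_intros(1)[OF assms(2)]] by blast
  show ?thesis
  proof (cases "PV u 3 \<in> C'")
    case True
    then have sub: "{w, PV u 3} \<subseteq> C' \<inter> vertex_path u" and "card {w, PV u 3} = 2"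
      using w unfolding vertex_path_def by auto
    then show ?thesis using True card_mono[OF fin sub] by simp
  next
    case False
    have "w \<in> C' \<inter> vertex_path u" using w unfolding vertex_path_def by auto
    then have "0 < card (C' \<inter> vertex_path u)" using fin card_gt_0_iff by blast
    then show ?thesis using False by simp
  qed
qed

lemma cover_gadget_bound:
  assumes cover: "\<And>f. f \<in> red_edges V E \<Longrightarrow> f \<inter> C' \<noteq> {}"
    and "e \<in> E" "x \<noteq> y" "e = {x, y}"
  shows "2 + of_bool (PV x 3 \<notin> C' \<and> PV y 3 \<notin> C') \<le> card (C' \<inter> edge_gadget e)"
proof -
  have fin: "finite (C' \<inter> edge_gadget e)" using assms(4) by (simp add: edge_gadget_def)
  have xy: "x \<in> e" "y \<in> e" using assms(4) by auto
  note edge = red_edges_intros[THEN cover]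
  have triangle: "{EVx e x, EVx e y, EW e} \<subseteq> edge_gadget e"
    using xy unfolding edge_gadget_def by auto
  have "2 \<le> card (C' \<inter> {EVx e x, EVx e y, EW e})"
    using triangle_cover[OF _ _ _ edge(3)[OF assms(2-4)] edge(4)[OF assms(2) xy(1)]
        edge(4)[OF assms(2) xy(2)]] assms(3) by simp
  also have "\<dots> \<le> card (C' \<inter> edge_gadget e)"
    using triangle fin by (intro card_mono) auto
  finally have two: "2 \<le> card (C' \<inter> edge_gadget e)" .
  show ?thesis
  proof (cases "PV x 3 \<notin> C' \<and> PV y 3 \<notin> C'")
    case True
    then have "EVx e x \<in> C'" "EVx e y \<in> C'"
      using edge(6)[OF assms(2) xy(1)] edge(6)[OF assms(2) xy(2)] by auto
    moreover obtain w where "w \<in> C'" "w = EW e \<or> w = EZ e" using edge(5)[OF assms(2)] by blast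
    ultimately have sub: "{EVx e x, EVx e y, w} \<subseteq> C' \<inter> edge_gadget e"
      and "card {EVx e x, EVx e y, w} = 3"
      using xy assms(3) unfolding edge_gadget_def by auto
    then show ?thesis using True card_mono[OF fin sub] by simp
  next
    case False
    then have "of_bool (PV x 3 \<notin> C' \<and> PV y 3 \<notin> C') = (0::nat)" by (simp only: of_bool_eq)
    then show ?thesis using two by (simp only: add_0_right)
  qed
qed

definition linked_vertices :: "'a set \<Rightarrow> 'a gvert set \<Rightarrow> 'a set" where
  "linked_vertices V C' = {u \<in> V. PV u 3 \<in> C'}"

lemma cover_block_count:
  assumes "graph V E" "vertex_cover (red_vertices V E) (red_edges V E) C'"
  defines "A \<equiv> linked_vertices V C'"
  shows "card V + card A + 2 * card E + card {e \<in> E. e \<inter> A = {}} \<le> card C'"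
proof -
  have cover: "\<And>f. f \<in> red_edges V E \<Longrightarrow> f \<inter> C' \<noteq> {}"
    and finC': "finite C'"
    using assms(2) finite_red_vertices[OF assms(1)] finite_subset
    unfolding vertex_cover_def by auto
  note fin = graph_finite[OF assms(1)]
  have "card V + card A = (\<Sum>u\<in>V. 1 + of_bool (PV u 3 \<in> C'))"
    unfolding sum.distrib using fin(1) by (simp add: A_def linked_vertices_def Int_def conj_commute)
  also have "\<dots> \<le> (\<Sum>u\<in>V. card (C' \<inter> vertex_path u))"
    using cover_path_bound[OF cover] by (intro sum_mono) auto
  finally have paths: "card V + card A \<le> (\<Sum>u\<in>V. card (C' \<inter> vertex_path u))" .
  have "2 * card E + card {e \<in> E. e \<inter> A = {}} = (\<Sum>e\<in>E. 2 + of_bool (e \<inter> A = {}))"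
    unfolding sum.distrib using fin(2) by (simp add: Int_def conj_commute)
  also have "\<dots> \<le> (\<Sum>e\<in>E. card (C' \<inter> edge_gadget e))"
  proof (rule sum_mono)
    fix e assume e: "e \<in> E"
    then obtain x y where xy: "x \<noteq> y" "x \<in> V" "y \<in> V" "e = {x, y}"
      using graph_edgeE[OF assms(1)] by blast
    then have "(e \<inter> A = {}) = (PV x 3 \<notin> C' \<and> PV y 3 \<notin> C')"
      unfolding A_def linked_vertices_def by auto
    then show "2 + of_bool (e \<inter> A = {}) \<le> card (C' \<inter> edge_gadget e)"
      using cover_gadget_bound[OF cover e xy(1,4)] by simp
  qed
  finally have gadgets: "2 * card E + card {e \<in> E. e \<inter> A = {}} \<le> (\<Sum>e\<in>E. card (C' \<inter> edge_gadget e))" .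
  have "(\<Sum>u\<in>V. card (C' \<inter> vertex_path u)) + (\<Sum>e\<in>E. card (C' \<inter> edge_gadget e)) \<le> card C'"
    using finC' fin(1,2) by (intro sum_card_blocks_le) (auto simp: vertex_path_def edge_gadget_def)
  then show ?thesis using paths gadgets by linarith
qed

lemma cover_project:
  assumes "graph V E" "vertex_cover (red_vertices V E) (red_edges V E) C'"
  shows "\<exists>C. vertex_cover V E C \<and> card V + card C + 2 * card E \<le> card C'"
proof -
  note fin = graph_finite[OF assms(1)]
  define A where "A = linked_vertices V C'"
  define B where "B = {e \<in> E. e \<inter> A = {}}"
  define C where "C = A \<union> (\<lambda>e. SOME x. x \<in> e) ` B"
  have pick: "(SOME x. x \<in> e) \<in> e" if "e \<in> E" for e
    using graph_edgeE[OF assms(1) that] by (metis insertI1 someI)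
  have "C \<subseteq> V"
    using pick fin(3) unfolding C_def A_def B_def linked_vertices_def by blast
  moreover have "e \<inter> C \<noteq> {}" if "e \<in> E" for e
    using pick[OF that] that unfolding C_def B_def by blast
  ultimately have "vertex_cover V E C" unfolding vertex_cover_def by blast
  moreover have "card C \<le> card A + card ((\<lambda>e. SOME x. x \<in> e) ` B)"
    unfolding C_def by (rule card_Un_le)
  moreover have "card ((\<lambda>e. SOME x. x \<in> e) ` B) \<le> card B"
    using fin(2) unfolding B_def by (simp add: card_image_le)
  moreover have "card V + card A + 2 * card E + card B \<le> card C'"
    using cover_block_count[OF assms] unfolding A_def B_def .
  ultimately show ?thesis by (intro exI[of _ C]) linarith
qed

lemma small_cover_iff_small_red_cover:
  assumes "graph V E"
  shows "(\<exists>C. vertex_cover V E C \<and> int (card C) \<le> int (card V) - int k)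
     \<longleftrightarrow> (\<exists>C'. vertex_cover (red_vertices V E) (red_edges V E) C'
               \<and> int (card C') \<le> 2 * int (card V + card E) - int k)"
proof
  assume "\<exists>C. vertex_cover V E C \<and> int (card C) \<le> int (card V) - int k"
  then show "\<exists>C'. vertex_cover (red_vertices V E) (red_edges V E) C'
               \<and> int (card C') \<le> 2 * int (card V + card E) - int k"
    using cover_lift[OF assms] by fastforce
next
  assume "\<exists>C'. vertex_cover (red_vertices V E) (red_edges V E) C'
               \<and> int (card C') \<le> 2 * int (card V + card E) - int k"
  then show "\<exists>C. vertex_cover V E C \<and> int (card C) \<le> int (card V) - int k"
    using cover_project[OF assms] by fastforce
qed

theorem mainTheorem10:
  fixes V :: "'a set" and E :: "'a set set" and t :: "'a set \<Rightarrow> 'a" and k :: nat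
  assumes "graph V E"
    and "\<forall>e\<in>E. t e \<in> e"
    and "k > 0"
  shows "maximal_matching (red_edges V E) (red_matching V E t)
       \<and> card (red_matching V E t) = card V + card E
       \<and> ((\<exists>S. independent_set V E S \<and> card S \<ge> k)
            \<longleftrightarrow> (\<exists>C. vertex_cover V E C \<and> int (card C) \<le> int (card V) - int k))
       \<and> ((\<exists>S. independent_set V E S \<and> card S \<ge> k)
            \<longleftrightarrow> (\<exists>C. vertex_cover (red_vertices V E) (red_edges V E) C
                     \<and> int (card C) \<le> 2 * int (card (red_matching V E t)) - int k))"
  using red_matching_maximal[OF assms(1,2)] card_red_matching[OF assms(1)]
    independent_set_iff_small_cover[OF assms(1)] small_cover_iff_small_red_cover[OF assms(1)]
  by simp

end
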